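(* Let $n\ge 1$ and let $z=(z_{ij})\in\mathbb{R}^{n\times n}$ and $w=(w_{ijkl})\in\mathbb{R}^{n^2\times n^2}$ have strictly positive entries (all indices range over $\{1,\dots,n\}$). Then the minimizer $(x,y)$ of $$\min_{(x,y)\in \mathrm{OLP}} \; KL(x\,\vert\, z)+KL(y\,\vert\, w)$$ over the one-sided local polytope $\mathrm{OLP}$ is given by $$q_{ij}=\exp\left(\frac{\log z_{ij}+\sum_{k}\log\big(\sum_{s} w_{ijks}\big)}{n+1}\right),\qquad x_{ij}=\frac{q_{ij}}{\sum_{s} q_{is}},\qquad y_{ijkl}=x_{ij}\,\frac{w_{ijkl}}{\sum_{s} w_{ijks}}$$ for all $i,j,k,l\in\{1,\dots,n\}$.
   Context: The one-sided local polytope $\mathrm{OLP}$ is the set of pairs $(x,y)$ with $x=(x_{ij})\in\mathbb{R}^{n\times n}$ and $y=(y_{ijkl})\in\mathbb{R}^{n^2\times n^2}$ satisfying $\sum_j x_{ij}=1$ for all $i$; $\sum_l y_{ijkl}=x_{ij}$ for all $i,j,k$; and $x\ge 0$, $y\ge 0$ entrywise. For a nonnegative array $a=(a_\gamma)$ and a strictly positive array $b=(b_\gamma)$ with the same index set, $KL(a\vert b)=\sum_\gamma a_\gamma\left(\log\frac{a_\gamma}{b_\gamma}-1\right)$, with the convention $0\log 0=0$. *)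

theory Defs
  imports "HOL-Analysis.Analysis"
begin

text \<open>The dimension is \<open>n = CARD('n)\<close>. An array \<open>y\<^sub>i\<^sub>j\<^sub>k\<^sub>l\<close> is an
  \<open>n\<^sup>2 \<times> n\<^sup>2\<close> matrix whose rows are indexed by the pairs \<open>(i, j)\<close> and whose
  columns are indexed by the pairs \<open>(k, l)\<close>.\<close>

definition OLP :: "((real ^ 'n ^ 'n) \<times> (real ^ ('n \<times> 'n) ^ ('n \<times> 'n))) set" where
  "OLP = {(x, y).
     (\<forall>i. (\<Sum>j\<in>UNIV. x $ i $ j) = 1) \<and>
     (\<forall>i j k. (\<Sum>l\<in>UNIV. y $ (i, j) $ (k, l)) = x $ i $ j) \<and>
     (\<forall>i j. 0 \<le> x $ i $ j) \<and>
     (\<forall>i j k l. 0 \<le> y $ (i, j) $ (k, l))}"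

text \<open>The convention \<open>0 log 0 = 0\<close> needs no case distinction: since \<open>ln\<close> is total, a summand
  with \<open>a $ i $ j = 0\<close> is \<open>0\<close>. The value is meaningful only for entrywise nonnegative \<open>a\<close> and
  entrywise positive \<open>b\<close>.\<close>

definition KL :: "real ^ 'm ^ 'l \<Rightarrow> real ^ 'm ^ 'l \<Rightarrow> real" where
  "KL a b = (\<Sum>i\<in>UNIV. \<Sum>j\<in>UNIV. a $ i $ j * (ln (a $ i $ j / b $ i $ j) - 1))"

end

theory Submission
  imports Defs
begin

text \<open>
  Writing \<open>D\<close> for the Bregman divergence of \<open>t \<mapsto> t (ln t - 1)\<close>, one has
  \<open>KL a b = D a c - \<Sum> c + \<Sum> a ln (c / b)\<close> for every positive \<open>c\<close>. For the claimed
  minimizer \<open>(x, y)\<close>, the linear functional \<open>\<Sum> x' ln (x / z) + \<Sum> y' ln (y / w)\<close> is constant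
  on \<open>OLP\<close>: the ratio \<open>y / w\<close> does not depend on \<open>l\<close>, so the marginal constraints collapse the
  functional to \<open>\<Sum> x' (n + 1) ln (x / q)\<close>, and \<open>ln (x / q)\<close> depends on \<open>i\<close> only. Hence the
  objective at \<open>(x', y')\<close> exceeds the one at \<open>(x, y)\<close> by exactly \<open>D x' x + D y' y\<close>.
\<close>

definition bregman :: "real \<Rightarrow> real \<Rightarrow> real" where
  "bregman a c = a * ln (a / c) - a + c"

lemma bregman_self [simp]: "bregman a a = 0"
  by (cases "a = 0") (simp_all add: bregman_def)

text \<open>This is \<open>ln u < u - 1\<close> for positive \<open>u \<noteq> 1\<close>, taken at
  \<open>u = c / a\<close> and multiplied by \<open>a\<close>. Strictness is what later yields
  uniqueness.\<close>

lemma bregman_pos: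
  assumes "0 \<le> a" "0 < c" "a \<noteq> c"
  shows "0 < bregman a c"
proof (cases "a = 0")
  case True
  then show ?thesis using assms by (simp add: bregman_def)
next
  case False
  with assms have a: "0 < a" by simp
  have "ln (c / a) \<noteq> c / a - 1"
    using ln_eq_minus_one[of "c / a"] a assms by auto
  moreover have "ln (c / a) \<le> c / a - 1"
    using a assms by (intro ln_le_minus_one) simp
  ultimately have "a * ln (c / a) < a * (c / a - 1)"
    using a by (intro mult_strict_left_mono) auto
  then show ?thesis
    using a assms by (simp add: bregman_def ln_div algebra_simps)
qed

lemma bregman_nonneg: "0 \<le> a \<Longrightarrow> 0 < c \<Longrightarrow> 0 \<le> bregman a c"
  using bregman_pos[of a c] by (cases "a = c") auto

definition Bregman :: "real ^ 'm ^ 'l \<Rightarrow> real ^ 'm ^ 'l \<Rightarrow> real" where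
  "Bregman a c = (\<Sum>i\<in>UNIV. \<Sum>j\<in>UNIV. bregman (a $ i $ j) (c $ i $ j))"

lemma Bregman_self [simp]: "Bregman a a = 0"
  by (simp add: Bregman_def)

lemma Bregman_nonneg:
  assumes "\<And>i j. 0 \<le> a $ i $ j" "\<And>i j. 0 < c $ i $ j"
  shows "0 \<le> Bregman a c"
  unfolding Bregman_def by (intro sum_nonneg bregman_nonneg assms)

lemma Bregman_eq_0D:
  assumes "\<And>i j. 0 \<le> a $ i $ j" "\<And>i j. 0 < c $ i $ j" "Bregman a c = 0"
  shows "a = c"
proof -
  have "bregman (a $ i $ j) (c $ i $ j) = 0" for i j
    using assms(3) unfolding Bregman_def
    by (simp add: sum_nonneg_eq_0_iff sum_nonneg bregman_nonneg assms(1,2))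
  then have "a $ i $ j = c $ i $ j" for i j
    using bregman_pos[OF assms(1,2)] by (metis less_irrefl)
  then show ?thesis by (simp add: vec_eq_iff)
qed

text \<open>Entrywise, \<open>ln (a / b) = ln (a / c) + ln (c / b)\<close>. Where \<open>a\<close>
  vanishes, both sides are \<open>0\<close>, because \<open>bregman 0 c = c\<close>.\<close>

lemma KL_eq_Bregman:
  fixes a b c :: "real ^ 'm ^ 'l"
  assumes "\<And>i j. 0 \<le> a $ i $ j" "\<And>i j. 0 < b $ i $ j" "\<And>i j. 0 < c $ i $ j"
  shows "KL a b = Bregman a c - (\<Sum>i\<in>UNIV. \<Sum>j\<in>UNIV. c $ i $ j)
    + (\<Sum>i\<in>UNIV. \<Sum>j\<in>UNIV. a $ i $ j * ln (c $ i $ j / b $ i $ j))"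
proof -
  have "a $ i $ j * (ln (a $ i $ j / b $ i $ j) - 1) =
      bregman (a $ i $ j) (c $ i $ j) - c $ i $ j + a $ i $ j * ln (c $ i $ j / b $ i $ j)" for i j
  proof (cases "a $ i $ j = 0")
    case False
    then show ?thesis
      using assms[of i j] by (simp add: bregman_def ln_div algebra_simps)
  qed (simp add: bregman_def)
  then show ?thesis
    unfolding KL_def Bregman_def by (simp add: sum.distrib sum_subtractf)
qed

lemma sum_UNIV_prod:
  fixes f :: "'a::finite \<times> 'b::finite \<Rightarrow> 'c::comm_monoid_add"
  shows "(\<Sum>p\<in>UNIV. f p) = (\<Sum>i\<in>UNIV. \<Sum>j\<in>UNIV. f (i, j))"
  by (simp add: sum.cartesian_product flip: UNIV_Times_UNIV)

theorem theorem2: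
  fixes z q x :: "real ^ 'n ^ 'n"
    and w y :: "real ^ ('n \<times> 'n) ^ ('n \<times> 'n)"
  assumes z_pos: "\<And>i j. 0 < z $ i $ j"
    and w_pos: "\<And>i j k l. 0 < w $ (i, j) $ (k, l)"
    and q: "\<And>i j. q $ i $ j =
      exp ((ln (z $ i $ j) + (\<Sum>k\<in>UNIV. ln (\<Sum>s\<in>UNIV. w $ (i, j) $ (k, s)))) / (real CARD('n) + 1))"
    and x: "\<And>i j. x $ i $ j = q $ i $ j / (\<Sum>s\<in>UNIV. q $ i $ s)"
    and y: "\<And>i j k l. y $ (i, j) $ (k, l) =
      x $ i $ j * (w $ (i, j) $ (k, l) / (\<Sum>s\<in>UNIV. w $ (i, j) $ (k, s)))"
  shows "\<forall>p. is_arg_min (\<lambda>(x', y'). KL x' z + KL y' w) (\<lambda>p. p \<in> OLP) p \<longleftrightarrow> p = (x, y)"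
proof -
  let ?F = "\<lambda>(x', y'). KL x' z + KL y' w"
  define W where "W i j k = (\<Sum>s\<in>UNIV. w $ (i, j) $ (k, s))" for i j k
  define S where "S i = (\<Sum>s\<in>UNIV. q $ i $ s)" for i
  have W_pos: "0 < W i j k" for i j k
    unfolding W_def by (intro sum_pos w_pos) auto
  have q_pos: "0 < q $ i $ j" for i j by (simp add: q)
  have S_pos: "0 < S i" for i
    unfolding S_def by (intro sum_pos q_pos) auto
  have x': "x $ i $ j = q $ i $ j / S i" for i j by (simp add: x S_def)
  have y': "y $ (i, j) $ (k, l) = x $ i $ j * (w $ (i, j) $ (k, l) / W i j k)" for i j k l
    by (simp add: y W_def)
  \<comment> \<open>Strict positivity of \<open>x\<close> and \<open>y\<close> lets them serve as
    the reference point \<open>c\<close> in \<open>KL_eq_Bregman\<close>.\<close>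
  have x_pos: "0 < x $ i $ j" for i j by (simp add: x' q_pos S_pos)
  have y_pos: "0 < y $ r $ s" for r s
    by (cases r; cases s) (simp add: y' x_pos w_pos W_pos)
  have w_pos': "0 < w $ r $ s" for r s
    by (cases r; cases s) (simp add: w_pos)
  have "(\<Sum>j\<in>UNIV. x $ i $ j) = 1" for i
    using S_pos[of i] by (simp add: x' S_def flip: sum_divide_distrib)
  moreover have "(\<Sum>l\<in>UNIV. y $ (i, j) $ (k, l)) = x $ i $ j" for i j k
    using W_pos[of i j k]
    by (simp add: y' flip: sum_divide_distrib sum_distrib_left W_def)
  ultimately have xy: "(x, y) \<in> OLP"
    by (auto simp: OLP_def intro: less_imp_le x_pos y_pos)

  \<comment> \<open>The Lagrange condition: \<open>ln (x $ i $ j)\<close> occurs once with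
    \<open>z\<close> and once for each \<open>k\<close>, whence the \<open>n + 1\<close> in
    \<open>q\<close>. The right side is free of \<open>j\<close>, like a multiplier of the row
    constraint.\<close>
  have stationary: "ln (x $ i $ j / z $ i $ j) + (\<Sum>k\<in>UNIV. ln (x $ i $ j / W i j k))
      = - (real CARD('n) + 1) * ln (S i)" for i j
  proof -
    have ln_q: "(real CARD('n) + 1) * ln (q $ i $ j) = ln (z $ i $ j) + (\<Sum>k\<in>UNIV. ln (W i j k))"
      by (simp add: q W_def)
    have ln_x: "ln (x $ i $ j) = ln (q $ i $ j) - ln (S i)"
      using q_pos[of i j] S_pos[of i] by (simp add: x' ln_div)
    have ln_ratio: "ln (x $ i $ j / z $ i $ j) = ln (x $ i $ j) - ln (z $ i $ j)"
      "ln (x $ i $ j / W i j k) = ln (x $ i $ j) - ln (W i j k)" for k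
      using x_pos[of i j] z_pos[of i j] W_pos[of i j k] by (simp_all add: ln_div)
    show ?thesis
      using ln_q unfolding ln_ratio ln_x by (simp add: sum_subtractf sum.distrib algebra_simps)
  qed
  have linear: "(\<Sum>i\<in>UNIV. \<Sum>j\<in>UNIV. a $ i $ j * ln (x $ i $ j / z $ i $ j))
      + (\<Sum>r\<in>UNIV. \<Sum>s\<in>UNIV. b $ r $ s * ln (y $ r $ s / w $ r $ s))
      = - (real CARD('n) + 1) * (\<Sum>i\<in>UNIV. ln (S i))" if ab: "(a, b) \<in> OLP" for a b
  proof -
    have ratio: "y $ (i, j) $ (k, l) / w $ (i, j) $ (k, l) = x $ i $ j / W i j k" for i j k l
      using w_pos[of i j k l] by (simp add: y')
    \<comment> \<open>The logarithm is free of \<open>l\<close>, so it leaves the innermost sum and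
      the marginal of \<open>b\<close> becomes \<open>a\<close>.\<close>
    have "(\<Sum>r\<in>UNIV. \<Sum>s\<in>UNIV. b $ r $ s * ln (y $ r $ s / w $ r $ s))
        = (\<Sum>i\<in>UNIV. \<Sum>j\<in>UNIV. \<Sum>k\<in>UNIV. a $ i $ j * ln (x $ i $ j / W i j k))"
      using ab by (simp add: sum_UNIV_prod ratio OLP_def flip: sum_distrib_right)
    then have "(\<Sum>i\<in>UNIV. \<Sum>j\<in>UNIV. a $ i $ j * ln (x $ i $ j / z $ i $ j))
        + (\<Sum>r\<in>UNIV. \<Sum>s\<in>UNIV. b $ r $ s * ln (y $ r $ s / w $ r $ s))
        = (\<Sum>i\<in>UNIV. \<Sum>j\<in>UNIV. a $ i $ j *
            (ln (x $ i $ j / z $ i $ j) + (\<Sum>k\<in>UNIV. ln (x $ i $ j / W i j k))))"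
      by (simp only: distrib_left sum.distrib sum_distrib_left)
    also have "\<dots> = (\<Sum>i\<in>UNIV. \<Sum>j\<in>UNIV. a $ i $ j * (- (real CARD('n) + 1) * ln (S i)))"
      by (simp only: stationary)
    also have "\<dots> = (\<Sum>i\<in>UNIV. - (real CARD('n) + 1) * ln (S i))"
      using ab by (simp add: OLP_def flip: sum_distrib_right)
    finally show ?thesis by (simp only: sum_distrib_left)
  qed
  have nonneg: "0 \<le> a $ i $ j" "0 \<le> b $ r $ s" if "(a, b) \<in> OLP" for a b i j r s
    using that by (cases r; cases s; auto simp: OLP_def)+
  \<comment> \<open>Both objective values are expanded around \<open>(x, y)\<close>. The linear
    parts agree by \<open>linear\<close>, the total masses of \<open>x\<close> and \<open>y\<close>
    cancel, and the divergence of \<open>(x, y)\<close> from itself is \<open>0\<close>.\<close>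
  have excess: "?F (a, b) = ?F (x, y) + Bregman a x + Bregman b y" if ab: "(a, b) \<in> OLP" for a b
    using linear[OF ab] linear[OF xy]
      KL_eq_Bregman[OF nonneg(1)[OF ab] z_pos x_pos] KL_eq_Bregman[OF nonneg(2)[OF ab] w_pos' y_pos]
      KL_eq_Bregman[OF nonneg(1)[OF xy] z_pos x_pos] KL_eq_Bregman[OF nonneg(2)[OF xy] w_pos' y_pos]
    by simp
  have B_nonneg: "0 \<le> Bregman a x" "0 \<le> Bregman b y" if ab: "(a, b) \<in> OLP" for a b
    by (intro Bregman_nonneg nonneg[OF ab] x_pos y_pos)+
  have least: "?F (x, y) \<le> ?F p" if "p \<in> OLP" for p
    using that excess B_nonneg by (cases p) force
  have unique: "p = (x, y)" if p: "p \<in> OLP" and le: "?F p \<le> ?F (x, y)" for p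
  proof -
    obtain a b where [simp]: "p = (a, b)" by (cases p)
    have ab: "(a, b) \<in> OLP" using p by simp
    have "Bregman a x = 0" "Bregman b y = 0"
      using excess[OF ab] B_nonneg[OF ab] le by auto
    then show ?thesis
      by (simp add: Bregman_eq_0D nonneg[OF ab] x_pos y_pos)
  qed
  \<comment> \<open>\<open>is_arg_min\<close> only excludes strictly smaller feasible values.
    Comparing a minimizer with the feasible \<open>(x, y)\<close> gives the inequality that
    \<open>unique\<close> requires.\<close>
  show ?thesis
    unfolding is_arg_min_def using xy least unique by (meson not_le)
qed

end
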